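(* There exist a constant $c>0$ and an integer $n_0$ such that for every integer $n\ge n_0$ there is a choice of a set $\mathcal{O}$ of obstructing unit cubes in $[0,n]^3$ for which the number of cubes in $\mathcal{O}$ that are visible from the observer cube $[0,1]^3$ adjacent to the origin is at least $c\,n^{8/3}$.
   Context: The cube $[0,n]^3$ is partitioned into $n^3$ axis-aligned unit cubes $[a_1,a_1+1]\times[a_2,a_2+1]\times[a_3,a_3+1]$ with $a_i\in\{0,\dots,n-1\}$. The observer is the unit cube $[0,1]^3$. A configuration is a set $\mathcal{O}$ of unit cubes of this partition, different from the observer, that are declared obstructing; all other cubes are empty and lines of sight pass through them freely. An obstructing cube $Q\in\mathcal{O}$ is visible from the observer if there are a point $x$ of the observer cube and a point $y\in Q$ such that the line segment from $x$ to $y$ is unobstructed, i.e. it does not meet any obstructing cube $Q'\in\mathcal{O}$ with $Q'\neq Q$. *)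

theory Defs
  imports "HOL-Analysis.Analysis"
begin

definition unit_cube :: "nat ^ 3 \<Rightarrow> (real ^ 3) set" where
  "unit_cube a = cbox (\<chi> i. real (a $ i)) (\<chi> i. real (a $ i) + 1)"

definition grid_cubes :: "nat \<Rightarrow> (real ^ 3) set set" where
  "grid_cubes n = {unit_cube a | a. \<forall>i. a $ i < n}"

definition observer :: "(real ^ 3) set" where
  "observer = unit_cube 0"

definition configuration :: "nat \<Rightarrow> (real ^ 3) set set \<Rightarrow> bool" where
  "configuration n Obs \<longleftrightarrow> Obs \<subseteq> grid_cubes n - {observer}"

text \<open>Cubes are closed, so a line of sight that merely touches the boundary of another
  obstructing cube is obstructed. The observer is never a member of a configuration.\<close>

definition visible :: "(real ^ 3) set set \<Rightarrow> (real ^ 3) set \<Rightarrow> bool" where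
  "visible Obs Q \<longleftrightarrow>
     (\<exists>x\<in>observer. \<exists>y\<in>Q. \<forall>Q'\<in>Obs. Q' \<noteq> Q \<longrightarrow> closed_segment x y \<inter> Q' = {})"

end

theory Submission
  imports Defs
begin

text \<open>Fix \<open>N = n div 6\<close> and consider the lines of slope \<open>(u/N, v/N)\<close> with \<open>u, v < N\<close>. At heights
  \<open>k \<ge> 3N\<close> the unit-width tubes of lines with different slopes are disjoint, so the tubes do not
  interact. In the tube of slope \<open>(u/N, v/N)\<close> the cell at height \<open>k\<close> is seen along a line of exactly
  that slope through the corner \<open>(i + 1, j + 1, k)\<close> of its front face, and such a line is obstructed by the cell at height
  \<open>k' < k\<close> only if the residues of \<open>k'u\<close> and \<open>k'v\<close> modulo \<open>N\<close> are dominated by those of \<open>ku\<close> and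
  \<open>kv\<close>. Hence the heights used in a tube only have to form an antichain for a three-dimensional
  product order. A union bound shows that for at least half of the slopes no difference \<open>d < e\<close>,
  with \<open>e\<close> of order \<open>N\<^sup>2\<^sup>/\<^sup>3\<close>, has both \<open>du mod N\<close> and \<open>dv mod N\<close> below \<open>e\<close>; for those slopes the
  heights with nearly constant \<open>k + (ku mod N) + (kv mod N)\<close> form an antichain, and by pigeonhole
  one of these level sets has at least \<open>e/3\<close> elements.\<close>

section \<open>Slopes whose small multiples avoid a corner square\<close>

text \<open>The quotient \<open>d * u div N\<close> and the block of length \<open>d\<close>
  containing the residue determine \<open>u\<close>, since they fix \<open>d * u\<close> up to an
  error below \<open>d\<close>. There are \<open>d\<close> quotients and about \<open>e / d\<close>
  blocks.\<close>

lemma card_small_multiples: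
  fixes d e N :: nat
  assumes "0 < d" "d \<le> e"
  shows "card {u. u < N \<and> d * u mod N < e} \<le> 2 * e"
proof -
  let ?U = "{u. u < N \<and> d * u mod N < e}"
  let ?f = "\<lambda>u. (d * u div N, (d * u mod N) div d)"
  have inj: "inj_on ?f ?U"
  proof (rule inj_onI)
    fix u w assume "u \<in> ?U" "w \<in> ?U" and eq: "?f u = ?f w"
    define r s j where "r = d * u mod N" and "s = d * w mod N" and "j = d * u div N"
    have u: "d * u = N * j + r" by (simp add: r_def j_def)
    have w: "d * w = N * j + s" using eq by (simp add: s_def j_def)
    have rs: "r div d = s div d" using eq by (simp add: r_def s_def)
    have "r < d * (s div d) + d" "s < d * (r div d) + d"
      using rs assms(1) dividend_less_times_div[of d r] dividend_less_times_div[of d s]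
      by (simp_all add: algebra_simps)
    moreover have "d * (s div d) \<le> s" "d * (r div d) \<le> r" by simp_all
    ultimately have "r < s + d" "s < r + d" by linarith+
    then have "d * u < d * Suc w" "d * w < d * Suc u" using u w by simp_all
    then have "u < Suc w" "w < Suc u" by (simp_all only: mult_less_cancel1)
    then show "u = w" by simp
  qed
  have sub: "?f ` ?U \<subseteq> {..<d} \<times> {..(e - 1) div d}"
  proof (rule image_subsetI)
    fix u assume "u \<in> ?U"
    then have "d * u div N < d" "d * u mod N div d \<le> (e - 1) div d"
      using assms by (auto simp: less_mult_imp_div_less intro!: div_le_mono)
    then show "?f u \<in> {..<d} \<times> {..(e - 1) div d}" by simp
  qed
  have "card ?U \<le> card ({..<d} \<times> {..(e - 1) div d})"
    using card_inj_on_le[OF inj sub] by simp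
  also have "\<dots> = d * ((e - 1) div d) + d" by simp
  also have "\<dots> \<le> (e - 1) + d" by (simp add: times_div_less_eq_dividend)
  also have "\<dots> \<le> 2 * e" using assms by simp
  finally show ?thesis .
qed

text \<open>The excluded square of residues is one-sided because only differences of dominated
  residues, which are nonnegative, have to be ruled out.\<close>

definition well_spread :: "nat \<Rightarrow> nat \<Rightarrow> nat \<Rightarrow> nat \<Rightarrow> bool" where
  "well_spread N e u v \<longleftrightarrow> (\<forall>d. 0 < d \<and> d < e \<longrightarrow> e \<le> d * u mod N \<or> e \<le> d * v mod N)"

text \<open>Each \<open>d\<close> spoils at most \<open>4 * e^2\<close> slopes, so all
  \<open>d < e\<close> together spoil at most \<open>4 * e^3\<close>, which is at most half of
  \<open>N^2\<close>.\<close>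

lemma card_well_spread:
  assumes "8 * e ^ 3 \<le> N ^ 2"
  shows "N ^ 2 \<le> 2 * card {(u, v). u < N \<and> v < N \<and> well_spread N e u v}"
proof -
  let ?S = "{..<N} \<times> {..<N}"
  let ?G = "{(u, v). u < N \<and> v < N \<and> well_spread N e u v}"
  let ?U = "\<lambda>d. {u. u < N \<and> d * u mod N < e}"
  have G: "finite ?G" by (rule finite_subset[of _ ?S]) auto
  have "?S \<subseteq> ?G \<union> (\<Union>d\<in>{0<..<e}. ?U d \<times> ?U d)"
    by (auto simp: well_spread_def not_le)
  then have "card ?S \<le> card (?G \<union> (\<Union>d\<in>{0<..<e}. ?U d \<times> ?U d))"
    using G by (intro card_mono) auto
  also have "\<dots> \<le> card ?G + card (\<Union>d\<in>{0<..<e}. ?U d \<times> ?U d)" by (rule card_Un_le)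
  also have "card (\<Union>d\<in>{0<..<e}. ?U d \<times> ?U d) \<le> (\<Sum>d\<in>{0<..<e}. card (?U d \<times> ?U d))"
    by (rule card_UN_le) simp
  also have "\<dots> \<le> (\<Sum>d\<in>{0<..<e}. (2 * e) * (2 * e))"
    unfolding card_cartesian_product by (intro sum_mono mult_le_mono card_small_multiples) auto
  also have "\<dots> \<le> e * ((2 * e) * (2 * e))" by simp
  finally have "N ^ 2 \<le> card ?G + 4 * e ^ 3"
    by (simp add: power2_eq_square power3_eq_cube card_cartesian_product algebra_simps)
  with assms show ?thesis by linarith
qed

section \<open>Antichains of heights\<close>

lemma mod_diff_eq_diff_mod:
  fixes k k' u N :: nat
  assumes "k' \<le> k" "k' * u mod N \<le> k * u mod N" "0 < N"
  shows "(k - k') * u mod N = k * u mod N - k' * u mod N"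
proof -
  have "(k - k') * u mod N = (k * u - k' * u) mod N" by (simp add: diff_mult_distrib)
  also have "int \<dots> = (int (k * u) - int (k' * u)) mod int N"
    using assms by (simp add: zmod_int of_nat_diff mult_right_mono)
  also have "\<dots> = (int (k * u mod N) - int (k' * u mod N)) mod int N"
    by (simp add: zmod_int mod_diff_eq)
  also have "\<dots> = int (k * u mod N - k' * u mod N)"
    using assms by (simp add: of_nat_diff less_imp_diff_less flip: zmod_int of_nat_diff)
  finally show ?thesis by (simp only: of_nat_eq_iff)
qed

definition staircase :: "nat \<Rightarrow> nat \<Rightarrow> nat \<Rightarrow> nat set \<Rightarrow> bool" where
  "staircase N u v K \<longleftrightarrow>
     (\<forall>k\<in>K. \<forall>k'\<in>K. k' < k \<longrightarrow> k * u mod N < k' * u mod N \<or> k * v mod N < k' * v mod N)"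

lemma staircase_exists:
  assumes "well_spread N e u v" "0 < e" "e \<le> N"
  shows "\<exists>K. K \<subseteq> {3 * N..<6 * N} \<and> staircase N u v K \<and> e \<le> 3 * card K"
proof -
  let ?A = "{3 * N..<6 * N}"
  define F where "F k = k + k * u mod N + k * v mod N" for k
  have N: "0 < N" using assms by simp
  have "(\<lambda>k. F k div e) \<in> ?A \<rightarrow> {..8 * N div e}"
  proof
    fix k assume "k \<in> ?A"
    moreover have "k * u mod N < N" "k * v mod N < N" using N by auto
    ultimately have "F k \<le> 8 * N" unfolding F_def atLeastLessThan_iff by linarith
    then show "F k div e \<in> {..8 * N div e}" by (simp add: div_le_mono)
  qed
  from pigeonhole_card[OF this] obtain q
    where q: "card ?A \<le> card ((\<lambda>k. F k div e) -` {q} \<inter> ?A) * card {..8 * N div e}"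
    by auto
  define K where "K = (\<lambda>k. F k div e) -` {q} \<inter> ?A"
  have "staircase N u v K"
    unfolding staircase_def
  proof (intro ballI impI, rule ccontr)
    fix k k' assume k: "k \<in> K" "k' \<in> K" "k' < k"
      and "\<not> (k * u mod N < k' * u mod N \<or> k * v mod N < k' * v mod N)"
    then have le: "k' * u mod N \<le> k * u mod N" "k' * v mod N \<le> k * v mod N" by auto
    have "F k div e = q" "F k' div e = q" using k by (auto simp: K_def)
    then have "F k = e * q + F k mod e" "F k' = e * q + F k' mod e"
      by (metis mult_div_mod_eq)+
    moreover have "F k mod e < e" using assms by simp
    \<comment> \<open>The three differences that sum to \<open>F k - F k'\<close> are nonnegative,
      so each is below \<open>e\<close>; then \<open>d = k - k'\<close> contradicts
      \<open>well_spread\<close>.\<close>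
    ultimately have "F k < F k' + e" by linarith
    then have "k - k' < e" "k * u mod N - k' * u mod N < e" "k * v mod N - k' * v mod N < e"
      using le k(3) by (auto simp: F_def)
    with mod_diff_eq_diff_mod[OF less_imp_le[OF k(3)] le(1) N]
      mod_diff_eq_diff_mod[OF less_imp_le[OF k(3)] le(2) N] assms(1) k(3)
    show False unfolding well_spread_def by (metis not_le zero_less_diff)
  qed
  moreover have "e \<le> 3 * card K"
  proof -
    \<comment> \<open>There are \<open>3 * N\<close> heights and at most
      \<open>8 * N / e + 1\<close>, hence at most \<open>9 * N / e\<close>, levels.\<close>
    have "3 * N * e \<le> card K * (e * (8 * N div e) + e)"
      using mult_le_mono1[OF q, of e] by (simp add: K_def algebra_simps)
    also have "\<dots> \<le> card K * (9 * N)"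
      using assms(3) times_div_less_eq_dividend[of e "8 * N"] by (intro mult_le_mono2) linarith
    finally show ?thesis using N by simp
  qed
  ultimately show ?thesis unfolding K_def by blast
qed

section \<open>Cells of a tube and lines of sight\<close>

text \<open>The lower corner of the cell that contains the point
  \<open>(k * u / N, k * v / N, k)\<close> of the line through the origin.\<close>

definition tube_cell :: "nat \<Rightarrow> nat \<Rightarrow> nat \<Rightarrow> nat \<Rightarrow> nat ^ 3" where
  "tube_cell N u v k = vector [k * u div N, k * v div N, k]"

lemma mem_unit_cube_tube_cell:
  "p \<in> unit_cube (tube_cell N u v k) \<longleftrightarrow>
     real (k * u div N) \<le> p $ 1 \<and> p $ 1 \<le> real (k * u div N) + 1 \<and>
     real (k * v div N) \<le> p $ 2 \<and> p $ 2 \<le> real (k * v div N) + 1 \<and>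
     real k \<le> p $ 3 \<and> p $ 3 \<le> real k + 1"
  by (auto simp: unit_cube_def tube_cell_def mem_box_cart forall_3)

lemma inj_unit_cube: "inj unit_cube"
proof (rule injI)
  fix a b assume eq: "unit_cube a = unit_cube b"
  have "(\<chi> i. real (c $ i)) \<in> unit_cube c" for c :: "nat ^ 3"
    by (simp add: unit_cube_def mem_box_cart)
  with eq have "(\<chi> i. real (a $ i)) \<in> unit_cube b" "(\<chi> i. real (b $ i)) \<in> unit_cube a" by auto
  then show "a = b" by (auto simp: unit_cube_def mem_box_cart vec_eq_iff intro: antisym)
qed

text \<open>The expression \<open>k * u div N + 1 - (k - z) * u / N\<close> is a coordinate, at height \<open>z\<close>, of the line of
  slope \<open>u/N\<close> through the upper end of the cell at height \<open>k\<close>.\<close>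

lemma sight_line_meets:
  fixes N u u' k k' :: nat and z :: real
  assumes u: "u < N" and k': "3 * N \<le> k'" and z: "real k' \<le> z" "z \<le> real k' + 1"
    and lo: "real (k' * u' div N) \<le> real (k * u div N) + 1 - (real k - z) * u / N"
    and hi: "real (k * u div N) + 1 - (real k - z) * u / N \<le> real (k' * u' div N) + 1"
  shows "u = u' \<and> k' * u mod N \<le> k * u mod N"
proof -
  define i r i' r' where "i = k * u div N" and "r = k * u mod N"
    and "i' = k' * u' div N" and "r' = k' * u' mod N"
  have N: "0 < N" using u by simp
  have r: "r < N" "r' < N" using N by (auto simp: r_def r'_def)
  have ku: "real k * u = N * real i + r" "real k' * u' = N * real i' + r'"
    unfolding i_def r_def i'_def r'_def
    by (metis mult_div_mod_eq of_nat_add of_nat_mult)+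
  \<comment> \<open>After multiplying by \<open>N\<close>, the identity
    \<open>N * i - k * u = - r\<close> leaves \<open>k\<close> present only through its
    residue.\<close>
  have lo': "N * real i' \<le> N - real r + z * u"
    using lo N ku(1) unfolding i_def[symmetric] i'_def[symmetric] by (simp add: field_simps)
  have hi': "z * u \<le> N * real i' + r"
    using hi N ku(1) unfolding i_def[symmetric] i'_def[symmetric] by (simp add: field_simps)
  have "real k' * u \<le> z * u" "z * u \<le> (real k' + 1) * u"
    using z by (auto intro: mult_right_mono)
  then have "real k' * u \<le> real k' * u' - r' + r" "real k' * u' < real k' * u + 3 * N"
    using lo' hi' ku r u by (auto simp: algebra_simps)
  then have 1: "real (k' * u + r') \<le> real (k' * u' + r)" and "real (k' * u') < real (k' * u + 3 * N)"
    by (auto simp: algebra_simps)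
  then have 2: "k' * u + r' \<le> k' * u' + r" and "k' * u' < k' * u + 3 * N"
    by (simp_all only: of_nat_le_iff of_nat_less_iff)
  \<comment> \<open>The bound \<open>3 * N \<le> k'\<close> makes one unit of slope outweigh the
    error terms, so the slopes agree; the first inequality of \<open>2\<close> then compares the
    residues.\<close>
  then have "k' * u' < k' * Suc u" "k' * u < k' * Suc u'" using k' r by auto
  then have "u' < Suc u" "u < Suc u'" by (simp_all only: mult_less_cancel1)
  then have "u = u'" by simp
  with 2 show ?thesis by (simp add: r_def r'_def)
qed

lemma tube_cell_visible:
  assumes T: "\<And>u v k. (u, v, k) \<in> T \<Longrightarrow> u < N \<and> v < N \<and> 3 * N \<le> k"
    and anti: "\<And>u v. staircase N u v {k. (u, v, k) \<in> T}"
    and mem: "(u, v, k) \<in> T"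
  shows "visible ((\<lambda>(u, v, k). unit_cube (tube_cell N u v k)) ` T) (unit_cube (tube_cell N u v k))"
  unfolding visible_def
proof (intro bexI ballI impI)
  define i j where "i = real (k * u div N)" and "j = real (k * v div N)"
  \<comment> \<open>\<open>x\<close> is the point at height 0 of the line of slope
    \<open>(u/N, v/N)\<close> through the corner \<open>y\<close>; it lies in the observer because
    \<open>k * u / N\<close> exceeds its floor by at most 1, and likewise for
    \<open>v\<close>.\<close>
  define x y :: "real ^ 3" where "x = vector [i + 1 - real k * u / N, j + 1 - real k * v / N, 0]"
    and "y = vector [i + 1, j + 1, real k]"
  have uv: "u < N" "v < N" using T[OF mem] by auto
  have frac: "real (k * w div N) \<le> real k * w / N" "real k * w / N \<le> real (k * w div N) + 1" for w
  proof -
    have N: "0 < N" using uv by simp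
    have "real k * w = N * real (k * w div N) + real (k * w mod N)"
      by (metis mult_div_mod_eq of_nat_add of_nat_mult)
    moreover have "k * w mod N < N" using N by simp
    ultimately show "real (k * w div N) \<le> real k * w / N" "real k * w / N \<le> real (k * w div N) + 1"
      using N by (auto simp: field_simps)
  qed
  show "x \<in> observer"
    using frac[of u] frac[of v]
    by (auto simp: observer_def unit_cube_def mem_box_cart forall_3 x_def i_def j_def)
  show "y \<in> unit_cube (tube_cell N u v k)"
    by (simp add: mem_unit_cube_tube_cell y_def i_def j_def)
  fix Q' assume Q': "Q' \<in> (\<lambda>(u, v, k). unit_cube (tube_cell N u v k)) ` T"
    and ne: "Q' \<noteq> unit_cube (tube_cell N u v k)"
  then obtain u' v' k' where mem': "(u', v', k') \<in> T"
    and Q'eq: "Q' = unit_cube (tube_cell N u' v' k')" by auto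
  show "closed_segment x y \<inter> Q' = {}"
  proof (rule ccontr)
    assume "closed_segment x y \<inter> Q' \<noteq> {}"
    then obtain t where t: "0 \<le> t" "t \<le> 1"
      and p: "(1 - t) *\<^sub>R x + t *\<^sub>R y \<in> unit_cube (tube_cell N u' v' k')"
      unfolding Q'eq closed_segment_def by auto
    define z where "z = t * k"
    have z: "z \<le> k" using t by (simp add: z_def mult_left_le_one_le)
    have coords: "((1 - t) *\<^sub>R x + t *\<^sub>R y) $ 1 = i + 1 - (k - z) * u / N"
      "((1 - t) *\<^sub>R x + t *\<^sub>R y) $ 2 = j + 1 - (k - z) * v / N"
      "((1 - t) *\<^sub>R x + t *\<^sub>R y) $ 3 = z"
      by (simp_all add: x_def y_def z_def algebra_simps diff_divide_distrib)
    note p' = p[unfolded mem_unit_cube_tube_cell coords i_def j_def]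
    have k': "3 * N \<le> k'" using T[OF mem'] by simp
    have 1: "u = u' \<and> k' * u mod N \<le> k * u mod N"
      using p' uv k' by (intro sight_line_meets[where z = z]) auto
    have 2: "v = v' \<and> k' * v mod N \<le> k * v mod N"
      using p' uv k' by (intro sight_line_meets[where z = z]) auto
    \<comment> \<open>Equal slopes and heights would make \<open>Q'\<close> the target itself;
      \<open>k' \<le> k\<close> holds because the segment stops at the front face, at height
      \<open>k\<close>.\<close>
    have "k' \<noteq> k" using ne 1 2 Q'eq by auto
    moreover have "k' \<le> k" using p' z by linarith
    ultimately have "k' < k" by simp
    with anti[of u v] mem mem' 1 2 show False
      unfolding staircase_def by (metis mem_Collect_eq not_le)
  qed
qed

lemma inj_on_tube_cell:
  assumes T: "\<And>u v k. (u, v, k) \<in> T \<Longrightarrow> u < N \<and> v < N \<and> 3 * N \<le> k"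
  shows "inj_on (\<lambda>(u, v, k). unit_cube (tube_cell N u v k)) T"
proof -
  have same: "u = u'" if eq: "k * u div N = k * u' div N" and "u < N" "3 * N \<le> k" for u u' k
  proof -
    \<comment> \<open>At height \<open>k\<close> the sight line is at the upper end of the common
      interval, so the separation of slopes applies with \<open>z = k\<close>.\<close>
    have "u = u' \<and> k * u mod N \<le> k * u mod N"
    proof (rule sight_line_meets[OF that(2,3), of "real k" u' k])
    qed (use eq in auto)
    then show ?thesis by simp
  qed
  show ?thesis
  proof (rule inj_onI)
    fix a b
    assume ab: "a \<in> T" "b \<in> T" "(case a of (u, v, k) \<Rightarrow> unit_cube (tube_cell N u v k)) =
      (case b of (u, v, k) \<Rightarrow> unit_cube (tube_cell N u v k))"
    obtain u v k u' v' k' where abeq: "a = (u, v, k)" "b = (u', v', k')"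
      by (metis prod_cases3)
    have mem: "(u, v, k) \<in> T" "(u', v', k') \<in> T"
      and "unit_cube (tube_cell N u v k) = unit_cube (tube_cell N u' v' k')"
      using ab unfolding abeq by auto
    then have eq: "tube_cell N u v k = tube_cell N u' v' k'" using inj_unit_cube by (auto dest: injD)
    have "k * u div N = k' * u' div N" "k * v div N = k' * v' div N" "k = k'"
      using arg_cong[OF eq, of "\<lambda>a. a $ 1"] arg_cong[OF eq, of "\<lambda>a. a $ 2"]
        arg_cong[OF eq, of "\<lambda>a. a $ 3"] by (simp_all add: tube_cell_def)
    then show "a = b"
      using same[of k u u'] same[of k v v'] T[OF mem(1)] by (simp add: abeq)
  qed
qed

section \<open>The configuration and its count\<close>

text \<open>All chosen cells are visible: at least \<open>N^2 / 2\<close> well-spread slopes carry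
  at least \<open>e / 3\<close> heights each.\<close>

lemma many_visible:
  assumes "0 < e" "8 * e ^ 3 \<le> N ^ 2" "e \<le> N" "6 * N \<le> n"
  shows "\<exists>Obs. configuration n Obs \<and> N ^ 2 * e \<le> 6 * card {Q \<in> Obs. visible Obs Q}"
proof -
  define G where "G = {(u, v). u < N \<and> v < N \<and> well_spread N e u v}"
  have "\<forall>g\<in>G. \<exists>K. K \<subseteq> {3 * N..<6 * N} \<and> staircase N (fst g) (snd g) K \<and> e \<le> 3 * card K"
    using staircase_exists assms by (auto simp: G_def)
  then obtain K where K: "\<And>g. g \<in> G \<Longrightarrow> K g \<subseteq> {3 * N..<6 * N}"
    "\<And>g. g \<in> G \<Longrightarrow> staircase N (fst g) (snd g) (K g)" "\<And>g. g \<in> G \<Longrightarrow> e \<le> 3 * card (K g)"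
    by metis
  have finK: "finite (K g)" if "g \<in> G" for g using K(1)[OF that] finite_subset by blast
  have finG: "finite G" by (rule finite_subset[of _ "{..<N} \<times> {..<N}"]) (auto simp: G_def)
  define T where "T = {(u, v, k). (u, v) \<in> G \<and> k \<in> K (u, v)}"
  define f where "f = (\<lambda>(u, v, k). unit_cube (tube_cell N u v k))"
  have T: "u < N \<and> v < N \<and> 3 * N \<le> k" "k < 6 * N" if "(u, v, k) \<in> T" for u v k
    using that K(1)[of "(u, v)"] by (auto simp: T_def G_def)
  have anti: "staircase N u v {k. (u, v, k) \<in> T}" for u v
    using K(2)[of "(u, v)"] by (auto simp: T_def staircase_def)
  have vis: "{Q \<in> f ` T. visible (f ` T) Q} = f ` T"
    using tube_cell_visible[OF T(1) anti] unfolding f_def by auto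
  have "configuration n (f ` T)"
    unfolding configuration_def
  proof
    fix Q assume "Q \<in> f ` T"
    then obtain u v k where mem: "(u, v, k) \<in> T" and Q: "Q = unit_cube (tube_cell N u v k)"
      by (auto simp: f_def)
    have lt: "k * w div N < n" if "w < N" for w
    proof -
      have "k * w \<le> k * N" using that by simp
      then have "k * w div N \<le> k" using that by (metis div_le_mono div_mult_self_is_m gr_zeroI not_less0)
      then show ?thesis using T(2)[OF mem] assms by simp
    qed
    have "Q \<in> grid_cubes n"
      unfolding grid_cubes_def Q using lt T[OF mem] assms
      by (auto simp: tube_cell_def forall_3 intro!: exI[of _ "tube_cell N u v k"])
    moreover have "tube_cell N u v k \<noteq> 0"
    proof
      assume "tube_cell N u v k = 0"
      from arg_cong[OF this, of "\<lambda>a. a $ 3"] have "k = 0" by (simp add: tube_cell_def)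
      then show False using T[OF mem] assms by simp
    qed
    then have "Q \<noteq> observer" using inj_unit_cube unfolding observer_def Q by (auto dest: injD)
    ultimately show "Q \<in> grid_cubes n - {observer}" by simp
  qed
  moreover have "N ^ 2 * e \<le> 6 * card (f ` T)"
  proof -
    have "bij_betw (\<lambda>(u, v, k). ((u, v), k)) T (SIGMA g:G. K g)"
      by (rule bij_betwI[where g = "\<lambda>((u, v), k). (u, v, k)"]) (auto simp: T_def)
    then have "card T = card (SIGMA g:G. K g)" by (rule bij_betw_same_card)
    also have "\<dots> = (\<Sum>g\<in>G. card (K g))" using finG finK by (simp add: card_SigmaI)
    finally have cT: "card T = (\<Sum>g\<in>G. card (K g))" .
    have "card (f ` T) = card T" unfolding f_def by (intro card_image inj_on_tube_cell T)
    moreover have "card G * e \<le> 3 * card T"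
      unfolding cT sum_distrib_left using sum_mono[OF K(3), of G] by simp
    moreover have "N ^ 2 * e \<le> (2 * card G) * e"
      using card_well_spread[OF assms(2)] unfolding G_def by (rule mult_le_mono1)
    ultimately show ?thesis by linarith
  qed
  ultimately show ?thesis using vis by metis
qed

theorem theorem3p1:
  "\<exists>c::real. c > 0 \<and> (\<exists>n0::nat. \<forall>n\<ge>n0. \<exists>Obs. configuration n Obs \<and>
     real (card {Q \<in> Obs. visible Obs Q}) \<ge> c * real n powr (8 / 3))"
proof -
  \<comment> \<open>The power of 1/12 comes from \<open>n \<le> 12 * N\<close>; 24 is the factor 6
    of \<open>many_visible\<close> times the 4 in \<open>N powr (2 / 3) / 4 \<le> e\<close>.\<close>
  let ?c = "(1 / 12) powr (8 / 3) / 24 :: real"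
  have "\<exists>Obs. configuration n Obs \<and> ?c * real n powr (8 / 3) \<le> real (card {Q \<in> Obs. visible Obs Q})"
    if n: "48 \<le> n" for n
  proof -
    define N where "N = n div 6"
    \<comment> \<open>The largest integer with \<open>8 * e^3 \<le> N^2\<close>. As
      \<open>48 \<le> n\<close> gives \<open>8 \<le> N\<close>, a number at least 2 is rounded down,
      losing at most a factor 2.\<close>
    define e where "e = nat \<lfloor>real N powr (2 / 3) / 2\<rfloor>"
    have N: "6 * N \<le> n" "n \<le> 12 * N" "8 \<le> N" using n by (auto simp: N_def)
    have "(8::real) powr (2 / 3) = (2 powr 3) powr (2 / 3)" by simp
    also have "\<dots> = 4" by (simp only: powr_powr) simp
    finally have P: "4 \<le> real N powr (2 / 3)"
      using N powr_mono2[of "2 / 3" 8 "real N"] by simp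
    have e: "real e \<le> real N powr (2 / 3) / 2" "real N powr (2 / 3) / 4 \<le> real e"
      using P unfolding e_def by linarith+
    have "8 * real e ^ 3 \<le> 8 * (real N powr (2 / 3) / 2) ^ 3"
      using e by (intro mult_left_mono power_mono) auto
    also have "\<dots> = (real N powr (2 / 3)) ^ 3" by (simp add: power_divide)
    also have "\<dots> = real N ^ 2" using N by (simp add: powr_power)
    finally have "real (8 * e ^ 3) \<le> real (N ^ 2)" by simp
    then have e3: "8 * e ^ 3 \<le> N ^ 2" by (simp only: of_nat_le_iff)
    have "real N powr (2 / 3) \<le> real N powr 1" using N by (intro powr_mono) auto
    then have "e \<le> N" using e N by simp
    moreover have "0 < e" using e P by simp
    ultimately obtain Obs where Obs: "configuration n Obs"
      and card: "N ^ 2 * e \<le> 6 * card {Q \<in> Obs. visible Obs Q}"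
      using many_visible[OF _ e3 _ N(1)] by blast
    have "?c * real n powr (8 / 3) = (real n / 12) powr (8 / 3) / 24"
      by (simp add: powr_divide)
    also have "\<dots> \<le> real N powr (8 / 3) / 24"
      using N by (intro divide_right_mono powr_mono2) auto
    also have "real N powr (8 / 3) = real N ^ 2 * real N powr (2 / 3)"
      using N powr_add[of "real N" 2 "2 / 3"] by simp
    also have "real N ^ 2 * real N powr (2 / 3) / 24 \<le> real N ^ 2 * (4 * real e) / 24"
      using e by (intro divide_right_mono mult_left_mono) auto
    also have "\<dots> = real (N ^ 2 * e) / 6" by simp
    also have "\<dots> \<le> real (6 * card {Q \<in> Obs. visible Obs Q}) / 6"
      using card by (intro divide_right_mono) (simp_all only: of_nat_le_iff)
    finally have "?c * real n powr (8 / 3) \<le> real (card {Q \<in> Obs. visible Obs Q})" by simp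
    with Obs show ?thesis by blast
  qed
  moreover have "0 < ?c" by simp
  ultimately show ?thesis by blast
qed

end
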